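(* Let $m_1,m_2$ be positive integers with $m_1 \neq m_2$, and let $G \in ER(n,d,m_1+m_2)$ have a uniform shared neighborhood structure. Then this uniform shared neighborhood structure is not isomorphic to the complete bipartite graph $K_{m_1,m_2}$.
   Context: For a finite simple graph $G$, $N(u)$ is the open neighborhood of a vertex $u$. $G \in ER(n,d,\lambda)$ means $G$ has $n$ vertices, is $d$-regular, and every pair of adjacent vertices has exactly $\lambda$ common neighbors. $G$ has a uniform shared neighborhood structure isomorphic to $H$ if the induced subgraph $G[N(u)\cap N(v)]$ is isomorphic to $H$ for all adjacent $u,v$.
   Formalization: The formal theorem additionally assumes that G has at least one edge; for an edgeless G (d = 0) every graph, including K_{m1,m2}, is vacuously a uniform shared neighborhood structure, so the literal statement fails there. *)

theory Defs
  imports "Graph_Theory.Graph_Theory"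
begin

text \<open>
  A finite simple graph is an instance of the locale \<^locale>\<open>graph\<close>: a finite, loop-free, symmetric
  digraph without parallel arcs. Every undirected edge is a pair of opposite arcs, hence the
  degree of a vertex is its out-degree.
\<close>

definition open_nbhd :: "('a, 'b) pre_digraph \<Rightarrow> 'a \<Rightarrow> 'a set" where
  "open_nbhd G u = {v. u \<rightarrow>\<^bsub>G\<^esub> v}"

definition ER :: "nat \<Rightarrow> nat \<Rightarrow> nat \<Rightarrow> ('a, 'b) pre_digraph set" where
  "ER n d l = {G. graph G \<and> card (verts G) = n
     \<and> (\<forall>u \<in> verts G. out_degree G u = d)
     \<and> (\<forall>u v. u \<rightarrow>\<^bsub>G\<^esub> v \<longrightarrow> card (open_nbhd G u \<inter> open_nbhd G v) = l)}"

text \<open>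
  If \<open>G\<close> has no edges, this holds vacuously for every \<open>H\<close>.
\<close>

definition uniform_shared_nbhd ::
    "('a, 'b) pre_digraph \<Rightarrow> ('c, 'd) pre_digraph \<Rightarrow> bool" where
  "uniform_shared_nbhd G H \<longleftrightarrow>
     (\<forall>u v. u \<rightarrow>\<^bsub>G\<^esub> v \<longrightarrow> digraph_iso (G \<restriction> (open_nbhd G u \<inter> open_nbhd G v)) H)"

end

theory Submission
  imports Defs
begin

text \<open>
  An edge inside a shared neighbourhood gives a clique \<open>u, v, x, y\<close>. Write \<open>c p q\<close> for the number of
  common neighbours of \<open>u\<close>, \<open>p\<close> and \<open>q\<close>. This is the degree of \<open>q\<close> in the complete bipartite graph
  induced on \<open>N(u) \<inter> N(p)\<close>, so it lies in \<open>{m\<^sub>1, m\<^sub>2}\<close>; and since adjacent vertices of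
  \<open>K\<^bsub>m\<^sub>1,m\<^sub>2\<^esub>\<close> have degree sum \<open>m\<^sub>1 + m\<^sub>2\<close>, the three equations
  \<open>c p q + c p r = m\<^sub>1 + m\<^sub>2\<close> for \<open>{p, q, r} = {v, x, y}\<close> force
  \<open>2 (c v x) = m\<^sub>1 + m\<^sub>2\<close>, whence \<open>m\<^sub>1 = m\<^sub>2\<close>.
\<close>

text \<open>The bipartition of \<open>K\<close> is pulled back along the vertex map of the
  isomorphism; injectivity on \<open>verts A\<close> preserves the sizes of the sides and lets
  adjacency be reflected as well as preserved.\<close>

lemma digraph_iso_complete_bipartite_digraphE:
  assumes "digraph_iso A K" and "complete_bipartite_digraph m n K"
  obtains U V where "verts A = U \<union> V" "U \<inter> V = {}" "card U = m" "card V = n"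
    "arcs_ends A = U \<times> V \<union> V \<times> U"
proof -
  obtain f where iso: "pre_digraph.digraph_isomorphism A f" and K: "K = app_iso f A"
    using assms(1) by (auto simp: digraph_iso_def)
  interpret A: wf_digraph A
    using iso by (simp add: pre_digraph.digraph_isomorphism_def)
  let ?f = "iso_verts f"
  have inj: "inj_on ?f (verts A)"
    using iso by (rule A.digraph_isomorphism_inj_on_verts)
  obtain U V where UV: "?f ` verts A = U \<union> V" "U \<inter> V = {}" "card U = m" "card V = n"
      "arcs_ends K = U \<times> V \<union> V \<times> U"
    using assms(2) by (auto simp: complete_bipartite_digraph_def K)
  have card_preimage: "card {x \<in> verts A. ?f x \<in> W} = card W" if "W \<subseteq> ?f ` verts A" for W
  proof -
    have "?f ` {x \<in> verts A. ?f x \<in> W} = W" using that by auto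
    moreover have "inj_on ?f {x \<in> verts A. ?f x \<in> W}"
      using inj by (rule inj_on_subset) auto
    ultimately show ?thesis using card_image by metis
  qed
  have ends: "(x, y) \<in> arcs_ends A \<longleftrightarrow> (?f x, ?f y) \<in> arcs_ends K"
    if "x \<in> verts A" "y \<in> verts A" for x y
  proof
    assume "(?f x, ?f y) \<in> arcs_ends K"
    then obtain a b where ab: "(a, b) \<in> arcs_ends A" "?f x = ?f a" "?f y = ?f b"
      unfolding K A.arcs_ends_app_iso_eq[OF iso] by auto
    then have "x = a" "y = b"
      using that A.adj_in_verts[OF ab(1)] inj by (blast dest: inj_onD)+
    then show "(x, y) \<in> arcs_ends A" using ab(1) by simp
  qed (auto simp: K A.arcs_ends_app_iso_eq[OF iso])
  show ?thesis
  proof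
    let ?U = "{x \<in> verts A. ?f x \<in> U}" and ?V = "{x \<in> verts A. ?f x \<in> V}"
    show "verts A = ?U \<union> ?V" "?U \<inter> ?V = {}" using UV by auto
    show "card ?U = m" "card ?V = n" using card_preimage UV by auto
    show "arcs_ends A = ?U \<times> ?V \<union> ?V \<times> ?U"
    proof (intro set_eqI, clarify)
      fix x y
      \<comment> \<open>\<open>ends\<close> covers only pairs of vertices of \<open>A\<close>; this
        excludes arcs between any other points.\<close>
      have "(x, y) \<in> arcs_ends A \<Longrightarrow> x \<in> verts A \<and> y \<in> verts A"
        using A.adj_in_verts by blast
      then show "(x, y) \<in> arcs_ends A \<longleftrightarrow> (x, y) \<in> ?U \<times> ?V \<union> ?V \<times> ?U"
        using ends[of x y] UV(5) by blast
    qed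
  qed
qed

lemma dominates_induce_subgraph_iff:
  "x \<rightarrow>\<^bsub>G \<restriction> S\<^esub> y \<longleftrightarrow> x \<rightarrow>\<^bsub>G\<^esub> y \<and> x \<in> S \<and> y \<in> S"
  by (auto simp: arcs_ends_conv)

text \<open>Inside \<open>S\<close>, the neighbours of a vertex are exactly the side opposite to it,
  and adjacent vertices have different opposite sides.\<close>

lemma bipartite_induced_nbhd:
  assumes "digraph_iso (G \<restriction> S) K" and "complete_bipartite_digraph m n K"
    and "x \<in> S" and "y \<in> S" and "x \<rightarrow>\<^bsub>G\<^esub> y"
  shows "card (S \<inter> open_nbhd G x) \<in> {m, n}"
    and "card (S \<inter> open_nbhd G x) + card (S \<inter> open_nbhd G y) = m + n"
proof -
  obtain U V where S: "S = U \<union> V" and "U \<inter> V = {}" "card U = m" "card V = n"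
      and ends: "arcs_ends (G \<restriction> S) = U \<times> V \<union> V \<times> U"
    by (rule digraph_iso_complete_bipartite_digraphE[OF assms(1,2)]) simp
  have dom: "p \<rightarrow>\<^bsub>G\<^esub> q \<longleftrightarrow> p \<in> U \<and> q \<in> V \<or> p \<in> V \<and> q \<in> U" if "p \<in> S" "q \<in> S" for p q
    using that ends dominates_induce_subgraph_iff[of p q G S] by auto
  have nbhd: "S \<inter> open_nbhd G p = (if p \<in> U then V else U)" if "p \<in> S" for p
    using that dom[OF that] S \<open>U \<inter> V = {}\<close> by (auto simp: open_nbhd_def)
  show "card (S \<inter> open_nbhd G x) \<in> {m, n}"
    using nbhd \<open>x \<in> S\<close> \<open>card U = m\<close> \<open>card V = n\<close> by auto
  show "card (S \<inter> open_nbhd G x) + card (S \<inter> open_nbhd G y) = m + n"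
    using nbhd dom assms(3-5) \<open>U \<inter> V = {}\<close> \<open>card U = m\<close> \<open>card V = n\<close> by auto
qed

theorem theorem5:
  fixes G :: "('a, 'b) pre_digraph"
    and H :: "('c, 'd) pre_digraph"
    and K :: "('e, 'f) pre_digraph"
    and n d m1 m2 :: nat
  assumes "m1 > 0" and "m2 > 0" and "m1 \<noteq> m2"
    and "G \<in> ER n d (m1 + m2)"
    and "arcs G \<noteq> {}"
    and "uniform_shared_nbhd G H"
    and "complete_bipartite_digraph m1 m2 K"
  shows "\<not> digraph_iso H K"
proof
  assume "digraph_iso H K"
  let ?N = "open_nbhd G"
  interpret graph G using assms(4) by (simp add: ER_def)
  have sym: "q \<rightarrow>\<^bsub>G\<^esub> p" if "p \<rightarrow>\<^bsub>G\<^esub> q" for p q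
    using that by (rule arcs_ends_symmetric[OF sym_arcs])
  have iso: "digraph_iso (G \<restriction> (?N p \<inter> ?N q)) K" if "p \<rightarrow>\<^bsub>G\<^esub> q" for p q
    using that assms(6) \<open>digraph_iso H K\<close>
    by (auto simp: uniform_shared_nbhd_def intro: digraph_iso_trans)
  obtain u v where "u \<rightarrow>\<^bsub>G\<^esub> v" using assms(5) by (auto simp: arcs_ends_def arc_to_ends_def)
  \<comment> \<open>Positivity of \<open>m1\<close> and \<open>m2\<close> makes both sides nonempty,
    so the shared neighbourhood contains an edge.\<close>
  obtain U V where "U \<noteq> {}" "V \<noteq> {}" "arcs_ends (G \<restriction> (?N u \<inter> ?N v)) = U \<times> V \<union> V \<times> U"
    using assms(1,2)
    by - (rule digraph_iso_complete_bipartite_digraphE[OF iso[OF \<open>u \<rightarrow>\<^bsub>G\<^esub> v\<close>] assms(7)],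
      metis card.empty less_irrefl)
  then obtain x y where "x \<rightarrow>\<^bsub>G \<restriction> (?N u \<inter> ?N v)\<^esub> y" by blast
  then have adj: "u \<rightarrow>\<^bsub>G\<^esub> v" "u \<rightarrow>\<^bsub>G\<^esub> x" "u \<rightarrow>\<^bsub>G\<^esub> y" "v \<rightarrow>\<^bsub>G\<^esub> x" "v \<rightarrow>\<^bsub>G\<^esub> y" "x \<rightarrow>\<^bsub>G\<^esub> y"
    using \<open>u \<rightarrow>\<^bsub>G\<^esub> v\<close> by (simp_all add: dominates_induce_subgraph_iff open_nbhd_def)
  define c where "c p q = card (?N u \<inter> ?N p \<inter> ?N q)" for p q
  have c_comm: "c p q = c q p" for p q by (simp add: c_def Int_ac)
  \<comment> \<open>Here \<open>S\<close> is \<open>?N p \<inter> ?N u\<close>, up to order, and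
    \<open>q\<close>, \<open>r\<close> are the adjacent vertices in it.\<close>
  have c: "c p q \<in> {m1, m2}" "c p q + c p r = m1 + m2"
    if "u \<rightarrow>\<^bsub>G\<^esub> p" "u \<rightarrow>\<^bsub>G\<^esub> q" "u \<rightarrow>\<^bsub>G\<^esub> r" "p \<rightarrow>\<^bsub>G\<^esub> q" "p \<rightarrow>\<^bsub>G\<^esub> r" "q \<rightarrow>\<^bsub>G\<^esub> r" for p q r
    using bipartite_induced_nbhd[OF iso[OF that(1)] assms(7), of q r] that
    unfolding c_def by (simp_all add: open_nbhd_def)
  have "c v x + c v y = m1 + m2" "c x v + c x y = m1 + m2" "c y v + c y x = m1 + m2"
      "c v x \<in> {m1, m2}"
    using c(2)[of v x y] c(2)[of x v y] c(2)[of y v x] c(1)[of v x y] adj adj[THEN sym] by simp_all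
  \<comment> \<open>By symmetry of \<open>c\<close> only three unknowns remain; their pairwise sums
    agree, so all three are equal.\<close>
  then show False
    using c_comm[of x v] c_comm[of y v] c_comm[of y x] \<open>m1 \<noteq> m2\<close> by auto
qed

end
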